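(* Let $N>1$, let $s\in\mathbb{N}$ with $1\le s<N/2$, and let $\bm{A}$ be an $m\times N$ real matrix. Let $R:\mathbb{R}^N\to[0,\infty)$ satisfy $R(z_1,\ldots,z_N)=R(|z_1|,\ldots,|z_N|)$ for all $\bm{z}=(z_1,\ldots,z_N)\in\mathbb{R}^N$, and suppose $R$ is symmetric on $\mathbb{R}^N$ and concave on $\mathcal{U}=[0,\infty)^N$. For $\bm{x}\in\mathbb{R}^N$ consider the problem $$(\mathrm{P}_R)\qquad \underset{\bm{z}\in\mathbb{R}^N}{\text{minimize}}\ R(\bm{z})\quad\text{subject to}\quad \bm{A}\bm{z}=\bm{A}\bm{x}.$$ (i) Suppose that $$R(z_1,\ldots,z_s,z_{s+1},0,\ldots,0)>R(z_1,\ldots,z_s,0,\ldots,0)\quad\text{for all } z_1,\ldots,z_{s+1}>0.$$ If $$\ker(\bm{A})\setminus\{\mathbf{0}\}\subset\big\{\bm{v}\in\mathbb{R}^N:\ \|\bm{v}_S\|_1<\|\bm{v}_{\overline{S}}\|_1\ \ \forall S\subset\{1,\ldots,N\}\text{ with }\#(S)\le s\big\},$$ then every $s$-sparse vector $\bm{x}\in\mathbb{R}^N$ is the unique solution to $(\mathrm{P}_R)$. (ii) Suppose that $$R(z_1,\ldots,z_{s-1},z_s,z_{s+1},0,\ldots,0)>R(z_1,\ldots,z_{s-1},z_s+z_{s+1},0,\ldots,0)\quad\text{for all } z_1,\ldots,z_{s+1}>0.$$ If $$\ker(\bm{A})\setminus\{\mathbf{0}\}\subset\big\{\bm{v}\in\mathbb{R}^N:\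 \|\bm{v}_S\|_1\le\|\bm{v}_{\overline{S}}\|_1\ \ \forall S\subset\{1,\ldots,N\}\text{ with }\#(S)\le s\big\},$$ then every $s$-sparse vector $\bm{x}\in\mathbb{R}^N$ that is not an equal-height vector is the unique solution to $(\mathrm{P}_R)$.
   Context: For $\bm{v}\in\mathbb{R}^N$ and $S\subset\{1,\ldots,N\}$: $\overline{S}$ is the complement of $S$ in $\{1,\ldots,N\}$, $\#(S)$ is the cardinality of $S$, and $\bm{v}_S\in\mathbb{R}^N$ is the vector that agrees with $\bm{v}$ on the coordinates in $S$ and is zero on the coordinates in $\overline{S}$. A vector is $s$-sparse if it has at most $s$ nonzero coordinates. A vector is equal-height if all its nonzero coordinates have the same magnitude (the zero vector is, vacuously, equal-height). $R$ is symmetric on $\mathbb{R}^N$ if $R(z_{\pi(1)},\ldots,z_{\pi(N)})=R(\bm{z})$ for every $\bm{z}\in\mathbb{R}^N$ and every permutation $\pi$ of $\{1,\ldots,N\}$. $R$ is concave on $\mathcal{U}$ if $R(\lambda\bm{z}+(1-\lambda)\bm{z}')\ge\lambda R(\bm{z})+(1-\lambda)R(\bm{z}')$ for all $\bm{z},\bm{z}'\in\mathcal{U}$ and $0\le\lambda\le1$. "$\bm{x}$ is the unique solution to $(\mathrm{P}_R)$" means that $\bm{x}$ is the unique global minimizer: $R(\bm{z})>R(\bm{x})$ for every $\bm{z}\ne\bm{x}$ with $\bm{A}\bm{z}=\bm{A}\bm{x}$. *)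

theory Defs
  imports "HOL-Analysis.Analysis"
begin

definition mat_ker :: "real ^ 'n ^ 'm \<Rightarrow> (real ^ 'n) set" where
  "mat_ker A = {v. A *v v = 0}"

definition restrict_vec :: "real ^ 'n \<Rightarrow> 'n set \<Rightarrow> real ^ 'n" where
  "restrict_vec v S = (\<chi> i. if i \<in> S then v $ i else 0)"

definition l1_norm :: "real ^ 'n \<Rightarrow> real" where
  "l1_norm v = (\<Sum>i\<in>UNIV. \<bar>v $ i\<bar>)"

definition sparse_vec :: "nat \<Rightarrow> real ^ 'n \<Rightarrow> bool" where
  "sparse_vec s v \<longleftrightarrow> card {i. v $ i \<noteq> 0} \<le> s"

definition equal_height :: "real ^ 'n \<Rightarrow> bool" where
  "equal_height v \<longleftrightarrow> (\<forall>i j. v $ i \<noteq> 0 \<longrightarrow> v $ j \<noteq> 0 \<longrightarrow> \<bar>v $ i\<bar> = \<bar>v $ j\<bar>)"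

definition symmetric_fun :: "(real ^ 'n \<Rightarrow> real) \<Rightarrow> bool" where
  "symmetric_fun R \<longleftrightarrow> (\<forall>z \<pi>. \<pi> permutes UNIV \<longrightarrow> R (\<chi> i. z $ \<pi> i) = R z)"

definition nonneg_orthant :: "(real ^ 'n) set" where
  "nonneg_orthant = {z. \<forall>i. 0 \<le> z $ i}"

text \<open>
  The index type carries no order, so the numbering \<open>1, \<dots>, N\<close> of the coordinates is a bijection
  \<open>idx\<close> from \<open>{1..N}\<close> onto the index type. With respect to it, \<open>leading_vec idx k z\<close> is the vector
  \<open>(z 1, \<dots>, z k, 0, \<dots>, 0)\<close>, for \<open>k \<le> N\<close>; the values of \<open>z\<close> outside \<open>{1..k}\<close> do not matter.
\<close>

definition leading_vec :: "(nat \<Rightarrow> 'n) \<Rightarrow> nat \<Rightarrow> (nat \<Rightarrow> real) \<Rightarrow> real ^ 'n" where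
  "leading_vec idx k z = (\<Sum>j = 1..k. axis (idx j) (z j))"

definition unique_solution ::
    "(real ^ 'n \<Rightarrow> real) \<Rightarrow> real ^ 'n ^ 'm \<Rightarrow> real ^ 'n \<Rightarrow> bool" where
  "unique_solution R A x \<longleftrightarrow> (\<forall>z. z \<noteq> x \<and> A *v z = A *v x \<longrightarrow> R z > R x)"

end

theory Submission
  imports Defs
begin

text \<open>
  A nonnegative concave function on the orthant is nondecreasing, and a symmetric one reverses weak
  supermajorization: if for every \<open>k\<close> the \<open>k\<close> smallest entries of \<open>a\<close> sum to at least
  the \<open>k\<close> smallest entries of \<open>b\<close>, then \<open>a\<close> dominates a convex combination of permutations
  of \<open>b\<close>, so \<open>R b \<le> R a\<close>. Adding the null space inequalities of \<open>v\<close> for two sets of size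
  \<open>s\<close> shows that \<open>\<bar>x + v\<bar>\<close> and \<open>\<bar>x\<bar>\<close> are related in this way. The remaining slack leaves room
  to perturb \<open>\<bar>x\<bar>\<close> to a vector with \<open>s + 1\<close> nonzero entries that still majorizes: under the
  strict inequalities, or if \<open>x\<close> has fewer than \<open>s\<close> nonzero entries, by adding a small amount to
  the coordinates of an \<open>(s + 1)\<close>-set containing the support; otherwise by splitting a small amount
  off the smallest nonzero entry. The latter needs \<open>x + v\<close> to have more
  than \<open>s\<close> nonzero entries, which can fail only for equal-height \<open>x\<close>. The growth hypothesis on
  \<open>R\<close> then makes the comparison strict.
\<close>

section \<open>Ordered enumerations and a rearrangement inequality\<close>

text \<open>Summation by parts as an induction: the weights decrease, so passing from
  \<open>c n\<close> to \<open>c (Suc n)\<close> in front of a nonnegative partial sum can only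
  lower it.\<close>

lemma abel_sum_lower:
  fixes c d :: "nat \<Rightarrow> real"
  assumes "\<And>k. k \<le> Suc n \<Longrightarrow> 0 \<le> (\<Sum>i<k. d i)" 
    and "\<And>i j. i \<le> j \<Longrightarrow> j \<le> n \<Longrightarrow> c j \<le> c i"
  shows "c n * (\<Sum>i<Suc n. d i) \<le> (\<Sum>i<Suc n. c i * d i)"
  using assms
proof (induction n)
  case (Suc n)
  have IH: "c n * (\<Sum>i<Suc n. d i) \<le> (\<Sum>i<Suc n. c i * d i)"
    by (rule Suc.IH) (use Suc.prems in auto)
  have "c (Suc n) * (\<Sum>i<Suc n. d i) \<le> c n * (\<Sum>i<Suc n. d i)"
    using Suc.prems(1)[of "Suc n"] Suc.prems(2)[of n "Suc n"] by (intro mult_right_mono) auto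
  then show ?case using IH by (simp add: algebra_simps)
qed simp

lemma sorted_enumeration:
  fixes c :: "'n::finite \<Rightarrow> real"
  obtains f where "bij_betw f {..<CARD('n)} UNIV"
    "\<And>i j. i \<le> j \<Longrightarrow> j < CARD('n) \<Longrightarrow> c (f i) \<le> c (f j)"
proof -
  obtain xs :: "'n list" where xs: "set xs = UNIV" "distinct xs"
    using finite_distinct_list[OF finite_class.finite_UNIV] by blast
  define ys where "ys = sort_key c xs"
  have ys: "set ys = UNIV" "distinct ys" "sorted (map c ys)" by (simp_all add: ys_def xs)
  have len: "length ys = CARD('n)" using distinct_card[OF ys(2)] ys(1) by simp
  have "bij_betw (nth ys) {..<CARD('n)} UNIV"
    using bij_betw_nth[OF ys(2)] ys(1) len by simp
  moreover have "c (ys ! i) \<le> c (ys ! j)" if "i \<le> j" "j < CARD('n)" for i j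
    using sorted_nth_mono[OF ys(3) that(1)] that len by simp
  ultimately show thesis by (rule that)
qed

text \<open>The last of the \<open>k\<close> listed values, \<open>b (g m)\<close>, bounds the
  listed values outside \<open>T\<close> from above and the unlisted values in \<open>T\<close> from
  below; there are equally many of both.\<close>

lemma sum_smallest_le:
  fixes b :: "'n::finite \<Rightarrow> real"
  assumes g: "bij_betw g {..<CARD('n)} UNIV"
    and mono: "\<And>i j. i \<le> j \<Longrightarrow> j < CARD('n) \<Longrightarrow> b (g i) \<le> b (g j)"
    and T: "card T = k"
  shows "(\<Sum>i<k. b (g i)) \<le> sum b T"
proof (cases k)
  case (Suc m)
  have kN: "k \<le> CARD('n)" using T card_mono[of UNIV T] by simp
  have inj: "inj_on g {..<CARD('n)}" using g by (rule bij_betw_imp_inj_on)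
  define G where "G = g ` {..<k}"
  have injk: "inj_on g {..<k}" by (rule inj_on_subset[OF inj]) (use kN in auto)
  have cG: "card G = k" by (simp add: G_def card_image[OF injk])
  have eq: "card (G - T) = card (T - G)"
    using card_Diff_subset_Int[of G T] card_Diff_subset_Int[of T G] T cG by (simp add: Int_commute)
  have "sum b (G - T) \<le> of_nat (card (G - T)) * b (g m)"
    by (rule sum_bounded_above) (use Suc kN in \<open>auto simp: G_def intro!: mono\<close>)
  also have "\<dots> = of_nat (card (T - G)) * b (g m)" by (simp add: eq)
  also have "\<dots> \<le> sum b (T - G)"
  proof (rule sum_bounded_below)
    fix i assume i: "i \<in> T - G"
    obtain j where j: "j < CARD('n)" "i = g j"
      using g by (metis UNIV_I bij_betw_imp_surj_on imageE lessThan_iff)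
    then have "\<not> j < k" using i by (auto simp: G_def)
    then show "b (g m) \<le> b i" using j Suc by (auto intro!: mono)
  qed
  finally have "sum b (G - T) \<le> sum b (T - G)" .
  moreover have "sum b G = sum b (G \<inter> T) + sum b (G - T)" by (simp add: sum.Int_Diff)
  moreover have "sum b T = sum b (G \<inter> T) + sum b (T - G)"
    using sum.Int_Diff[of T b G] by (simp add: Int_commute)
  moreover have "(\<Sum>i<k. b (g i)) = sum b G" by (simp add: G_def sum.reindex[OF injk])
  ultimately show ?thesis by simp
qed (use T in auto)

text \<open>The permutation hands the smallest entries of \<open>b\<close> to the largest weights.
  By \<open>W\<close> the partial sums of the differences \<open>d\<close> in this order are
  nonnegative, and summation by parts applies.\<close>

lemma rearrangement_le:
  fixes a b c :: "'n::finite \<Rightarrow> real"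
  assumes W: "\<And>T. \<exists>T'. card T' = card T \<and> sum b T' \<le> sum a T"
    and c: "\<And>i. 0 \<le> c i"
  obtains \<pi> where "\<pi> permutes UNIV" "(\<Sum>i\<in>UNIV. c i * b (\<pi> i)) \<le> (\<Sum>i\<in>UNIV. c i * a i)"
proof -
  let ?N = "CARD('n)"
  obtain f where f: "bij_betw f {..<?N} UNIV" 
    and fm: "\<And>i j. i \<le> j \<Longrightarrow> j < ?N \<Longrightarrow> - c (f i) \<le> - c (f j)"
    using sorted_enumeration[of "\<lambda>i. - c i"] by blast
  obtain g where g: "bij_betw g {..<?N} UNIV"
    and gm: "\<And>i j. i \<le> j \<Longrightarrow> j < ?N \<Longrightarrow> b (g i) \<le> b (g j)"
    using sorted_enumeration[of b] by blast
  define \<pi> where "\<pi> = g \<circ> inv_into {..<?N} f"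
  have "bij_betw \<pi> UNIV UNIV"
    unfolding \<pi>_def using bij_betw_inv_into[OF f] g by (rule bij_betw_trans)
  then have perm: "\<pi> permutes UNIV" by (rule bij_imp_permutes) simp
  have \<pi>f: "\<pi> (f i) = g i" if "i < ?N" for i
    using that f by (simp add: \<pi>_def bij_betw_inv_into_left)
  have reindex: "(\<Sum>i\<in>UNIV. h i) = (\<Sum>i<?N. h (f i))" for h :: "'n \<Rightarrow> real"
    by (rule sum.reindex_bij_betw[OF f, symmetric])
  define d where "d i = a (f i) - b (g i)" for i
  obtain n where n: "?N = Suc n" using zero_less_card_finite[where 'a='n] by (cases ?N) auto
  have D: "0 \<le> (\<Sum>i<k. d i)" if k: "k \<le> ?N" for k
  proof -
    have inj: "inj_on f {..<k}" 
      by (rule inj_on_subset[OF bij_betw_imp_inj_on[OF f]]) (use k in auto)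
    obtain T' where T': "card T' = card (f ` {..<k})" "sum b T' \<le> sum a (f ` {..<k})"
      using W by blast
    have "card T' = k" using T'(1) by (simp add: card_image[OF inj])
    then have "(\<Sum>i<k. b (g i)) \<le> sum b T'" by (intro sum_smallest_le g gm)
    also have "\<dots> \<le> (\<Sum>i<k. a (f i))" using T'(2) by (simp add: sum.reindex[OF inj])
    finally show ?thesis by (simp add: d_def sum_subtractf)
  qed
  have "0 \<le> c (f n) * (\<Sum>i<?N. d i)" using c D[of ?N] by simp
  also have "\<dots> \<le> (\<Sum>i<?N. c (f i) * d i)"
    unfolding n using abel_sum_lower[of n d "\<lambda>i. c (f i)"] D fm unfolding n by force
  also have "\<dots> = (\<Sum>i<?N. c (f i) * a (f i)) - (\<Sum>i<?N. c (f i) * b (\<pi> (f i)))"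
    by (simp add: d_def \<pi>f algebra_simps sum_subtractf)
  finally have "(\<Sum>i\<in>UNIV. c i * b (\<pi> i)) \<le> (\<Sum>i\<in>UNIV. c i * a i)"
    by (simp add: reindex[of "\<lambda>i. c i * b (\<pi> i)"] reindex[of "\<lambda>i. c i * a i"])
  then show thesis using perm that by blast
qed

section \<open>Concave symmetric functions and majorization\<close>

text \<open>Otherwise a hyperplane separates the compact hull from the closed convex set below
  \<open>a\<close>. Its normal \<open>c\<close> is nonnegative because that set is unbounded
  downwards in every coordinate, and \<open>rearrangement_le\<close> then yields a permutation of
  \<open>b\<close> on the wrong side.\<close>

lemma exists_hull_permutations_le:
  fixes a b :: "real ^ 'n"
  assumes W: "\<And>T. \<exists>T'. card T' = card T \<and> (\<Sum>i\<in>T'. b $ i) \<le> (\<Sum>i\<in>T. a $ i)"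
  obtains h where "h \<in> convex hull {\<chi> i. b $ \<pi> i | \<pi>. \<pi> permutes UNIV}" "\<And>i. h $ i \<le> a $ i"
proof (rule ccontr)
  let ?P = "{\<chi> i. b $ \<pi> i | \<pi>. \<pi> permutes (UNIV :: 'n set)}"
  let ?Y = "{y :: real ^ 'n. \<forall>i. y $ i \<le> a $ i}"
  assume "\<not> thesis"
  then have disj: "convex hull ?P \<inter> ?Y = {}" using that by blast
  have "finite ?P" using finite_permutations[of "UNIV :: 'n set"] by simp
  then have comp: "compact (convex hull ?P)" by (rule finite_imp_compact_convex_hull)
  have "id permutes (UNIV :: 'n set)" by (rule permutes_id)
  then have "?P \<noteq> {}" by blast
  then have ne: "convex hull ?P \<noteq> {}" by simp
  have "closed ?Y" unfolding Collect_all_eq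
    by (intro closed_INT ballI closed_Collect_le continuous_intros)
  moreover have "convex ?Y" by (auto simp: convex_def intro!: convex_bound_le)
  ultimately obtain c \<beta> where h: "\<forall>x\<in>?Y. c \<bullet> x < \<beta>" "\<forall>x\<in>convex hull ?P. c \<bullet> x > \<beta>"
    using separating_hyperplane_closed_compact[of ?Y "convex hull ?P"] comp ne disj
    by (auto simp: Int_commute)
  have c: "0 \<le> c $ i" for i
  proof (rule ccontr)
    assume "\<not> 0 \<le> c $ i"
    then have neg: "c $ i < 0" by simp
    \<comment> \<open>Lowering coordinate \<open>i\<close> of \<open>a\<close> by \<open>t\<close>
      raises the inner product with \<open>c\<close> to at least \<open>\<beta>\<close>; the
      \<open>max\<close> with 0 keeps the point below \<open>a\<close>.\<close>
    define t where "t = max 0 ((\<beta> - c \<bullet> a) / (- (c $ i)))"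
    have "a - t *\<^sub>R axis i 1 \<in> ?Y" by (auto simp: t_def axis_def)
    then have "c \<bullet> (a - t *\<^sub>R axis i 1) < \<beta>" using h(1) by blast
    then have "c \<bullet> a - t * c $ i < \<beta>" by (simp add: inner_diff_right inner_axis)
    moreover have "(\<beta> - c \<bullet> a) / (- (c $ i)) \<le> t" by (simp add: t_def)
    then have "\<beta> - c \<bullet> a \<le> t * (- (c $ i))" using neg by (simp add: divide_simps split: if_splits)
    ultimately show False by simp
  qed
  obtain \<pi> where \<pi>: "\<pi> permutes UNIV"
    "(\<Sum>i\<in>UNIV. c $ i * b $ \<pi> i) \<le> (\<Sum>i\<in>UNIV. c $ i * a $ i)"
    using rearrangement_le[of "\<lambda>i. b $ i" "\<lambda>i. a $ i" "\<lambda>i. c $ i"] W c by blast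
  have "(\<chi> i. b $ \<pi> i) \<in> convex hull ?P" using \<pi>(1) by (intro hull_inc) blast
  then have "\<beta> < c \<bullet> (\<chi> i. b $ \<pi> i)" using h(2) by blast
  moreover have "c \<bullet> (\<chi> i. b $ \<pi> i) \<le> c \<bullet> a" using \<pi>(2) by (simp add: inner_vec_def)
  moreover have "c \<bullet> a < \<beta>" using h(1) by simp
  ultimately show False by simp
qed

text \<open>If \<open>R\<close> dropped between \<open>h\<close> and \<open>a\<close>, concavity
  would keep it dropping at least as fast along the ray beyond \<open>a\<close>, which stays in the
  orthant, until it became negative.\<close>

lemma nonneg_concave_mono:
  fixes R :: "real ^ 'n \<Rightarrow> real"
  assumes nonneg: "\<And>z. 0 \<le> R z" and conc: "concave_on nonneg_orthant R"
    and h: "\<And>i. 0 \<le> h $ i" and le: "\<And>i. h $ i \<le> a $ i"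
  shows "R h \<le> R a"
proof (rule ccontr)
  assume "\<not> R h \<le> R a"
  then have lt: "R a < R h" by simp
  \<comment> \<open>Makes \<open>t * (R h - R a)\<close> exceed \<open>R h\<close>. As
    \<open>a\<close> lies at the fraction \<open>1/t\<close> of the way from \<open>h\<close> to
    \<open>y\<close>, concavity would then force \<open>R y < 0\<close>.\<close>
  define t where "t = 1 + R h / (R h - R a)"
  have "t * (R h - R a) = (R h - R a) + R h" using lt by (simp add: t_def distrib_right)
  then have t: "1 \<le> t" "R h < t * (R h - R a)" using lt nonneg[of h] by (simp_all add: t_def)
  define y where "y = h + t *\<^sub>R (a - h)"
  have y: "y \<in> nonneg_orthant" using h le t(1) by (simp add: y_def nonneg_orthant_def)
  have hn: "h \<in> nonneg_orthant" using h by (simp add: nonneg_orthant_def)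
  have "(1 - 1/t) *\<^sub>R h + (1/t) *\<^sub>R y = a" using t(1) by (simp add: y_def algebra_simps)
  moreover have "(1 - 1/t) * R h + (1/t) * R y \<le> R ((1 - 1/t) *\<^sub>R h + (1/t) *\<^sub>R y)"
    using t(1) by (intro concave_onD[OF conc _ _ hn y]) auto
  ultimately have "(1 - 1/t) * R h + (1/t) * R y \<le> R a" by simp
  moreover have "0 \<le> (1/t) * R y" using t(1) nonneg by simp
  ultimately have "(1 - 1/t) * R h \<le> R a" by linarith
  then have "t * ((1 - 1/t) * R h) \<le> t * R a" using t(1) by (intro mult_left_mono) auto
  then show False using t by (simp add: algebra_simps)
qed

text \<open>The hypothesis on subset sums says that \<open>b\<close> weakly supermajorizes \<open>a\<close>.\<close>
lemma symmetric_concave_supermajorization: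
  fixes R :: "real ^ 'n \<Rightarrow> real"
  assumes nonneg: "\<And>z. 0 \<le> R z" and sym: "symmetric_fun R" and conc: "concave_on nonneg_orthant R"
    and b: "\<And>i. 0 \<le> b $ i"
    and W: "\<And>T. \<exists>T'. card T' = card T \<and> (\<Sum>i\<in>T'. b $ i) \<le> (\<Sum>i\<in>T. a $ i)"
  shows "R b \<le> R a"
proof -
  let ?P = "{\<chi> i. b $ \<pi> i | \<pi>. \<pi> permutes (UNIV :: 'n set)}"
  let ?L = "{z \<in> nonneg_orthant. R b \<le> R z}"
  obtain h where h: "h \<in> convex hull ?P" "\<And>i. h $ i \<le> a $ i"
    using exists_hull_permutations_le[of b a] W by blast
  have sub: "?P \<subseteq> ?L" using sym b by (auto simp: symmetric_fun_def nonneg_orthant_def)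
  have "convex ?L"
  proof (rule convexI)
    fix x y :: "real ^ 'n" and u v :: real
    assume *: "x \<in> ?L" "y \<in> ?L" "0 \<le> u" "0 \<le> v" "u + v = 1"
    have "R b = u * R b + v * R b" using *(5) by (metis distrib_right mult_1)
    also have "\<dots> \<le> u * R x + v * R y" using * by (intro add_mono mult_left_mono) auto
    also have "\<dots> \<le> R (u *\<^sub>R x + v *\<^sub>R y)" using conc * unfolding concave_on_iff by blast
    finally show "u *\<^sub>R x + v *\<^sub>R y \<in> ?L" using * by (simp add: nonneg_orthant_def)
  qed
  then have "h \<in> ?L" using h(1) hull_minimal[OF sub] by blast
  then show ?thesis
    using nonneg_concave_mono[OF nonneg conc, of h a] h(2) by (force simp: nonneg_orthant_def)
qed

section \<open>Moving leading coordinates to an arbitrary support\<close>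

lemma card_Compl_add:
  fixes S :: "'n::finite set"
  shows "card (- S) + card S = CARD('n)"
  using card_Un_disjoint[of "- S" S] by (simp add: Compl_partition2)

lemma leading_vec_nth: "leading_vec idx k z $ i = (\<Sum>j = 1..k. if idx j = i then z j else 0)"
  by (auto simp: leading_vec_def axis_def intro!: sum.cong)

text \<open>Carries the growth hypotheses, stated for leading coordinates, to vectors supported in
  any \<open>k\<close>-set \<open>T\<close>. The bijection from the leading coordinates onto
  \<open>T\<close> extends to a permutation because the complements have equal size.\<close>

lemma symmetric_fun_leading_vec:
  fixes R :: "real ^ 'n \<Rightarrow> real"
  assumes sym: "symmetric_fun R" and idx: "bij_betw idx {1..CARD('n)} UNIV"
    and h: "bij_betw h {1..k} T" and supp: "\<And>i. i \<notin> T \<Longrightarrow> y $ i = 0"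
  shows "R (leading_vec idx k (\<lambda>j. y $ h j)) = R y"
proof -
  have "k = card T" using bij_betw_same_card[OF h] by simp
  then have kN: "k \<le> CARD('n)" using card_mono[of UNIV T] by simp
  define I where "I = idx ` {1..k}"
  have inj: "inj_on idx {1..CARD('n)}" using idx by (rule bij_betw_imp_inj_on)
  have idxk: "bij_betw idx {1..k} I"
    using inj_on_subset[OF inj, of "{1..k}"] kN by (simp add: bij_betw_def I_def)
  define g where "g = h \<circ> inv_into {1..k} idx"
  have g: "bij_betw g I T" unfolding g_def using bij_betw_inv_into[OF idxk] h by (rule bij_betw_trans)
  have "card (- I) = card (- T)" using bij_betw_same_card[OF g] card_Compl_add[of I] card_Compl_add[of T] by linarith
  then obtain g' where g': "bij_betw g' (- I) (- T)"
    using finite_same_card_bij[of "- I" "- T"] by auto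
  define \<pi> where "\<pi> i = (if i \<in> I then g i else g' i)" for i
  have "bij_betw \<pi> I T" using g by (rule bij_betw_cong[THEN iffD1, rotated]) (simp add: \<pi>_def)
  moreover have "bij_betw \<pi> (- I) (- T)"
    using g' by (rule bij_betw_cong[THEN iffD1, rotated]) (simp add: \<pi>_def)
  ultimately have "bij_betw \<pi> (I \<union> - I) (T \<union> - T)" by (rule bij_betw_combine) simp
  then have "bij_betw \<pi> UNIV UNIV" by simp
  then have perm: "\<pi> permutes UNIV" by (rule bij_imp_permutes) simp
  have "(\<chi> i. y $ \<pi> i) $ i = leading_vec idx k (\<lambda>j. y $ h j) $ i" for i
  proof -
    obtain j where j: "j \<in> {1..CARD('n)}" "i = idx j" using idx by (metis UNIV_I bij_betw_iff_bijections)
    have eq: "idx j' = i \<longleftrightarrow> j' = j" if "j' \<in> {1..k}" for j'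
      using inj_on_eq_iff[OF inj] that j kN by auto
    have "leading_vec idx k (\<lambda>j. y $ h j) $ i = (\<Sum>j' = 1..k. if j' = j then y $ h j' else 0)"
      unfolding leading_vec_nth by (rule sum.cong) (simp_all add: eq)
    also have "\<dots> = (if j \<in> {1..k} then y $ h j else 0)" by (simp add: sum.delta)
    also have "\<dots> = y $ \<pi> i"
    proof (cases "j \<in> {1..k}")
      case True
      then have "g i = h j" using j bij_betw_inv_into_left[OF idxk True] by (simp add: g_def)
      moreover have "i \<in> I" using True j by (auto simp: I_def)
      ultimately show ?thesis using True by (simp add: \<pi>_def)
    next
      case False
      have "i \<notin> I"
      proof
        assume "i \<in> I"
        then obtain j' where "j' \<in> {1..k}" "idx j' = i" by (auto simp: I_def)
        then show False using eq[of j'] False by simp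
      qed
      then have "\<pi> i \<notin> T" using bij_betwE[OF g'] by (auto simp: \<pi>_def)
      then show ?thesis using supp False by auto
    qed
    finally show ?thesis by simp
  qed
  then have "leading_vec idx k (\<lambda>j. y $ h j) = (\<chi> i. y $ \<pi> i)" by (simp add: vec_eq_iff)
  then show ?thesis using sym perm by (simp add: symmetric_fun_def)
qed

section \<open>Subset sums under the null space property\<close>

text \<open>The least of finitely many positive gaps, divided by \<open>c\<close>. The scale is
  \<open>CARD('n)\<close> when up to that many coordinates are raised by \<open>\<epsilon>\<close>,
  and 1 otherwise.\<close>

lemma uniform_slack:
  fixes f g :: "'a \<Rightarrow> real"
  assumes "finite F" "\<And>t. t \<in> F \<Longrightarrow> f t < g t" "0 < c"
  shows "\<exists>\<epsilon>>0. \<forall>t\<in>F. f t + \<epsilon> * c \<le> g t"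
  using assms(1,2)
proof (induction F)
  case (insert t F)
  then obtain \<epsilon> where \<epsilon>: "\<epsilon> > 0" "\<forall>t\<in>F. f t + \<epsilon> * c \<le> g t" by auto
  define \<delta> where "\<delta> = min \<epsilon> ((g t - f t) / c)"
  have "f t < g t" using insert.prems by simp
  then have "\<delta> > 0" using \<epsilon>(1) \<open>0 < c\<close> by (simp add: \<delta>_def)
  moreover have "\<delta> * c \<le> ((g t - f t) / c) * c" using \<open>0 < c\<close> by (intro mult_right_mono) (auto simp: \<delta>_def)
  then have "f t + \<delta> * c \<le> g t" using \<open>0 < c\<close> by simp
  moreover have "f u + \<delta> * c \<le> g u" if "u \<in> F" for u
  proof -
    have "\<delta> * c \<le> \<epsilon> * c" using \<open>0 < c\<close> by (intro mult_right_mono) (auto simp: \<delta>_def)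
    then show ?thesis using \<epsilon>(2) that by force
  qed
  ultimately show ?case by auto
qed (auto intro: exI[of _ 1])

text \<open>Add the two bounds and rewrite \<open>sum w S + sum w S'\<close> as union plus
  intersection: the union cancels against the total and leaves the part outside.\<close>

lemma sum_inter_le_sum_outside:
  fixes w :: "'n::finite \<Rightarrow> real"
  assumes "2 * sum w S + \<delta> \<le> sum w UNIV" "2 * sum w S' + \<delta> \<le> sum w UNIV"
  shows "sum w (S \<inter> S') + \<delta> \<le> sum w (- S \<inter> - S')"
proof -
  have "sum w (S \<union> S') + sum w (S \<inter> S') = sum w S + sum w S'" by (rule sum.union_inter) auto
  moreover have "sum w UNIV = sum w (S \<union> S') + sum w (- (S \<union> S'))"
    using sum.Int_Diff[of UNIV w "S \<union> S'"] by (simp add: Compl_eq_Diff_UNIV)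
  ultimately show ?thesis using assms by simp
qed

text \<open>Obtained by adding the null space property for \<open>S\<close> and for \<open>J \<union> - T\<close>.\<close>
lemma nsp_exchange:
  fixes w :: "'n::finite \<Rightarrow> real"
  assumes nsp: "\<And>S'. card S' = s \<Longrightarrow> 2 * sum w S' + \<delta> \<le> sum w UNIV"
    and S: "card S = s" and J: "J \<subseteq> S \<inter> T" "card J + CARD('n) = card T + s"
  shows "sum w J + sum w (S - T) + \<delta> \<le> sum w (T - S)"
proof -
  have disj: "J \<inter> - T = {}" using J by auto
  have "card (- T) + card T = CARD('n)"
    by (rule card_Compl_add)
  then have "card (J \<union> - T) = s" using card_Un_disjoint[of J "- T"] disj J(2) by simp
  then have *: "sum w (S \<inter> (J \<union> - T)) + \<delta> \<le> sum w (- S \<inter> - (J \<union> - T))"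
    using nsp S by (intro sum_inter_le_sum_outside) auto
  have "S \<inter> (J \<union> - T) = J \<union> (S - T)" "- S \<inter> - (J \<union> - T) = T - S" using J by auto
  moreover have "sum w (J \<union> (S - T)) = sum w J + sum w (S - T)"
    using J by (intro sum.union_disjoint) auto
  ultimately show ?thesis using * by simp
qed

lemma sum_abs_shift_ge:
  fixes x v :: "real ^ 'n"
  assumes "\<And>i. i \<notin> S \<Longrightarrow> x $ i = 0" and "J \<subseteq> S \<inter> T"
  shows "(\<Sum>i\<in>J. \<bar>x $ i + v $ i\<bar>) + (\<Sum>i\<in>T - S. \<bar>v $ i\<bar>) \<le> (\<Sum>i\<in>T. \<bar>x $ i + v $ i\<bar>)"
proof -
  have "(\<Sum>i\<in>T - S. \<bar>v $ i\<bar>) = (\<Sum>i\<in>T - S. \<bar>x $ i + v $ i\<bar>)"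
    using assms(1) by (intro sum.cong) auto
  then have "(\<Sum>i\<in>J. \<bar>x $ i + v $ i\<bar>) + (\<Sum>i\<in>T - S. \<bar>v $ i\<bar>) = (\<Sum>i\<in>J \<union> (T - S). \<bar>x $ i + v $ i\<bar>)"
    using assms(2) by (subst sum.union_disjoint) auto
  also have "\<dots> \<le> (\<Sum>i\<in>T. \<bar>x $ i + v $ i\<bar>)" using assms(2) by (intro sum_mono2) auto
  finally show ?thesis .
qed

text \<open>The triangle inequality on \<open>J\<close> loses the mass of \<open>v\<close> there;
  \<open>nsp_exchange\<close> recovers it from \<open>T - S\<close>, where \<open>x + v\<close>
  equals \<open>v\<close>. The size of \<open>J\<close> is chosen so that
  \<open>J \<union> - S\<close> is as large as \<open>T\<close>, and \<open>x\<close> vanishes on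
  \<open>- S\<close>.\<close>

lemma subset_sum_shift_ge:
  fixes x v :: "real ^ 'n"
  assumes nsp: "\<And>S'. card S' = s \<Longrightarrow> 2 * (\<Sum>i\<in>S'. \<bar>v $ i\<bar>) + \<delta> \<le> (\<Sum>i\<in>UNIV. \<bar>v $ i\<bar>)"
    and S: "card S = s" "\<And>i. i \<notin> S \<Longrightarrow> x $ i = 0"
    and J: "J \<subseteq> S \<inter> T" "card J + CARD('n) = card T + s"
  shows "(\<Sum>i\<in>J. \<bar>x $ i\<bar>) + (\<Sum>i\<in>S - T. \<bar>v $ i\<bar>) + \<delta> \<le> (\<Sum>i\<in>T. \<bar>x $ i + v $ i\<bar>)"
proof -
  have "(\<Sum>i\<in>J. \<bar>x $ i\<bar>) \<le> (\<Sum>i\<in>J. \<bar>x $ i + v $ i\<bar> + \<bar>v $ i\<bar>)" by (intro sum_mono) auto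
  then show ?thesis
    using nsp_exchange[of s "\<lambda>i. \<bar>v $ i\<bar>" \<delta> S J T] sum_abs_shift_ge[of S x J T v] assms
    by (simp add: sum.distrib)
qed

text \<open>Such a \<open>J\<close> fits because \<open>S\<close> and \<open>T\<close> overlap in at
  least \<open>card T + s - CARD('n)\<close> points. The strict inequality in the last conclusion
  says that \<open>J\<close> is nonempty, which leaves room for a prescribed point
  \<open>i\<close>.\<close>

lemma obtain_inter_subset:
  fixes S T :: "'n::finite set"
  assumes "card S = s" "CARD('n) \<le> card T + s"
  obtains J where "J \<subseteq> S \<inter> T" "card J + CARD('n) = card T + s"
    "i \<in> S \<inter> T \<Longrightarrow> CARD('n) < card T + s \<Longrightarrow> i \<in> J"
proof -
  have "card (S \<union> T) + card (S \<inter> T) = card S + card T" by (rule card_Un_Int[symmetric]) auto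
  moreover have "card (S \<union> T) \<le> CARD('n)" by (rule card_mono) auto
  ultimately have le: "card T + s - CARD('n) \<le> card (S \<inter> T)" using assms by linarith
  show thesis
  proof (cases "i \<in> S \<inter> T \<and> CARD('n) < card T + s")
    case True
    have "card T + s - CARD('n) - 1 \<le> card (S \<inter> T - {i})" using le True by simp
    then obtain K where K: "K \<subseteq> S \<inter> T - {i}" "card K = card T + s - CARD('n) - 1"
      by (rule obtain_subset_with_card_n)
    have "card (insert i K) = Suc (card K)" using K(1) by (intro card_insert_disjoint) auto
    then show thesis using K True by (intro that[of "insert i K"]) auto
  next
    case False
    obtain K where "K \<subseteq> S \<inter> T" "card K = card T + s - CARD('n)" 
      using le by (rule obtain_subset_with_card_n)
    then show thesis using assms(2) False by (intro that[of K]) auto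
  qed
qed

text \<open>Handles small sets in the majorization test: a set of the same size exists on which a
  vector supported in \<open>insert e S\<close> sums to 0.\<close>

lemma obtain_subset_avoiding:
  fixes S :: "'n::finite set"
  assumes "e \<notin> S" "card T + card S < CARD('n)"
  obtains T' where "T' \<subseteq> - insert e S" "card T' = card T"
proof -
  have "card (- insert e S) + card (insert e S) = CARD('n)"
    by (rule card_Compl_add)
  moreover have "card (insert e S) = Suc (card S)" using assms(1) by simp
  ultimately have "card T \<le> card (- insert e S)" using assms(2) by linarith
  then show thesis using obtain_subset_with_card_n that by metis
qed

section \<open>Strict comparison through vectors with \<open>s + 1\<close> nonzero entries\<close>

locale concave_penalty =
  fixes R :: "real ^ 'n \<Rightarrow> real" and idx :: "nat \<Rightarrow> 'n" and s :: nat
  assumes nonneg: "\<And>z. 0 \<le> R z"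
    and abs_eq: "\<And>z. R z = R (\<chi> i. \<bar>z $ i\<bar>)"
    and sym: "symmetric_fun R"
    and conc: "concave_on nonneg_orthant R"
    and idx: "bij_betw idx {1..CARD('n)} UNIV"
    and s: "1 \<le> s" "s < CARD('n)"
begin

lemmas mono = nonneg_concave_mono[OF nonneg conc]
lemmas supermajorization = symmetric_concave_supermajorization[OF nonneg sym conc]
lemmas leading = symmetric_fun_leading_vec[OF sym idx]

text \<open>The chain is \<open>b\<close>, \<open>y'\<close>, \<open>y\<close>, \<open>a\<close>:
  monotonicity gives the first comparison, \<open>incr\<close> the strict second one, and
  supermajorization the third, with \<open>\<epsilon>\<close> small enough for the raised entries to
  fit into the slack.\<close>

lemma less_of_strict_subset_sums:
  assumes incr: "\<forall>z. (\<forall>j\<in>{1..s+1}. z j > 0) \<longrightarrow>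
      R (leading_vec idx s z) < R (leading_vec idx (s+1) z)"
    and S: "card S = s"
    and b: "\<And>i. 0 \<le> b $ i" "\<And>i. i \<notin> S \<Longrightarrow> b $ i = 0" and a: "\<And>i. 0 \<le> a $ i"
    and less: "\<And>T. CARD('n) \<le> card T + s \<Longrightarrow>
      \<exists>J\<subseteq>S. card J + CARD('n) = card T + s \<and> (\<Sum>i\<in>J. b $ i) < (\<Sum>i\<in>T. a $ i)"
  shows "R b < R a"
proof -
  have "S \<noteq> UNIV" using S s by auto
  then obtain e where e: "e \<notin> S" by auto
  \<comment> \<open>Only these sets need slack; smaller ones can be matched outside
    \<open>insert e S\<close>.\<close>
  define F :: "'n set set" where "F = {T. CARD('n) \<le> card T + s}"
  obtain J where J: "\<And>T. T \<in> F \<Longrightarrow> J T \<subseteq> S \<and> card (J T) + CARD('n) = card T + s \<and>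
      (\<Sum>i\<in>J T. b $ i) < (\<Sum>i\<in>T. a $ i)"
    using less unfolding F_def by (metis mem_Collect_eq)
  obtain \<epsilon> :: real where \<epsilon>: "\<epsilon> > 0" "\<And>T. T \<in> F \<Longrightarrow> (\<Sum>i\<in>J T. b $ i) + \<epsilon> * CARD('n) \<le> (\<Sum>i\<in>T. a $ i)"
    using uniform_slack[of F "\<lambda>T. \<Sum>i\<in>J T. b $ i" "\<lambda>T. \<Sum>i\<in>T. a $ i" "real CARD('n)"] J by auto
  define y where "y = (\<chi> i. b $ i + (if i \<in> insert e S then \<epsilon> else 0))"
  define y' where "y' = (\<chi> i. b $ i + (if i \<in> S then \<epsilon> else 0))"
  have "R b \<le> R y'" using b \<epsilon>(1) by (intro mono) (auto simp: y'_def)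
  also have "R y' < R y"
  proof -
    obtain h where h: "bij_betw h {1..s} S"
      using finite_same_card_bij[of "{1..s}" S] S by auto
    \<comment> \<open>With \<open>e\<close> in the last place, cutting off position
      \<open>s+1\<close> leaves \<open>S\<close>, on which \<open>y\<close> and \<open>y'\<close>
      agree.\<close>
    define h' where "h' = h(s+1 := e)"
    have "bij_betw h' {1..s} S" using h 
      by (rule bij_betw_cong[THEN iffD1, rotated]) (simp add: h'_def)
    moreover from this have "bij_betw h' ({1..s} \<union> {s+1}) (S \<union> {e})"
      by (rule bij_betw_combine) (use e in \<open>auto simp: h'_def\<close>)
    moreover have "{1..s} \<union> {s+1} = {1..s+1}" by auto
    ultimately have h': "bij_betw h' {1..s} S" "bij_betw h' {1..s+1} (insert e S)" by auto
    have "R y' = R (leading_vec idx s (\<lambda>j. y' $ h' j))"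
      using leading[OF h'(1), of y'] b by (simp add: y'_def)
    also have "leading_vec idx s (\<lambda>j. y' $ h' j) = leading_vec idx s (\<lambda>j. y $ h' j)"
      using bij_betwE[OF h'(1)] by (auto simp: vec_eq_iff leading_vec_nth y_def y'_def intro!: sum.cong)
    also have "R \<dots> < R (leading_vec idx (s+1) (\<lambda>j. y $ h' j))"
      using bij_betwE[OF h'(2)] b(1) \<epsilon>(1) by (intro incr[rule_format]) (auto simp: y_def intro!: add_nonneg_pos)
    also have "\<dots> = R y" using leading[OF h'(2), of y] b by (simp add: y_def)
    finally show ?thesis .
  qed
  also have "R y \<le> R a"
  proof (rule supermajorization)
    fix T :: "'n set"
    show "\<exists>T'. card T' = card T \<and> (\<Sum>i\<in>T'. y $ i) \<le> (\<Sum>i\<in>T. a $ i)"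
    proof (cases "T \<in> F")
      case True
      define T' where "T' = J T \<union> - S"
      have disj: "J T \<inter> - S = {}" using J[OF True] by auto
      have "card (- S) + s = CARD('n)" using card_Compl_add[of S] S by simp
      then have "card T' = card T"
        using card_Un_disjoint[of "J T" "- S"] disj J[OF True] by (simp add: T'_def)
      moreover have "(\<Sum>i\<in>T'. y $ i) \<le> (\<Sum>i\<in>T'. b $ i + \<epsilon>)"
        using \<epsilon>(1) by (intro sum_mono) (auto simp: y_def)
      moreover have "\<dots> \<le> (\<Sum>i\<in>T'. b $ i) + \<epsilon> * CARD('n)"
        using \<epsilon>(1) card_mono[of UNIV T'] by (simp add: sum.distrib)
      moreover have "(\<Sum>i\<in>T'. b $ i) = (\<Sum>i\<in>J T. b $ i)"
        unfolding T'_def using disj b by (subst sum.union_disjoint) auto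
      ultimately show ?thesis using \<epsilon>(2)[OF True] by force
    next
      case False
      then obtain T' where T': "T' \<subseteq> - insert e S" "card T' = card T"
        using obtain_subset_avoiding[OF e, of T] S by (auto simp: F_def)
      have "(\<Sum>i\<in>T'. y $ i) = 0" using T'(1) b by (intro sum.neutral) (auto simp: y_def)
      then show ?thesis using T'(2) a by (auto intro!: exI[of _ T'] sum_nonneg)
    qed
  qed (use b \<epsilon>(1) in \<open>auto simp: y_def\<close>)
  finally show ?thesis .
qed

text \<open>An amount \<open>\<epsilon>\<close> moves from the smallest positive entry of
  \<open>b\<close>, at \<open>p\<close>, to a zero coordinate \<open>e\<close>, and
  \<open>split\<close> makes \<open>R\<close> grow strictly. Sums over \<open>K \<union> - S\<close>
  with \<open>p\<close> in \<open>K\<close> do not change, so the majorization by \<open>a\<close>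
  survives.\<close>

lemma less_of_split:
  assumes split: "\<forall>z. (\<forall>j\<in>{1..s+1}. z j > 0) \<longrightarrow>
      R (leading_vec idx s (z(s := z s + z (s+1)))) < R (leading_vec idx (s+1) z)"
    and S: "card S = s"
    and b: "\<And>i. i \<in> S \<Longrightarrow> 0 < b $ i" "\<And>i. i \<notin> S \<Longrightarrow> b $ i = 0" and a: "\<And>i. 0 \<le> a $ i"
    and le: "\<And>T. CARD('n) \<le> card T + s \<Longrightarrow>
      \<exists>J\<subseteq>S. card J + CARD('n) = card T + s \<and> (\<Sum>i\<in>J. b $ i) \<le> (\<Sum>i\<in>T. a $ i)"
    and pos: "\<And>T. card T + s = CARD('n) \<Longrightarrow> 0 < (\<Sum>i\<in>T. a $ i)"
  shows "R b < R a"
proof -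
  have "S \<noteq> UNIV" using S s by auto
  then obtain e where e: "e \<notin> S" by auto
  have "S \<noteq> {}" using S s by auto
  then have "Min ((\<lambda>i. b $ i) ` S) \<in> (\<lambda>i. b $ i) ` S" by (intro Min_in) auto
  then obtain p where p: "p \<in> S" "Min ((\<lambda>i. b $ i) ` S) = b $ p" by auto
  have pmin: "b $ p \<le> b $ i" if "i \<in> S" for i
    using that p(2) by (metis Min_le finite finite_imageI imageI)
  \<comment> \<open>Sets of size \<open>CARD('n) - s\<close> are matched with \<open>- S\<close>,
    where \<open>y\<close> sums to \<open>\<epsilon>\<close>; \<open>pos\<close> provides room for
    that.\<close>
  obtain \<epsilon>1 where \<epsilon>1: "\<epsilon>1 > 0" "\<And>T. card T + s = CARD('n) \<Longrightarrow> \<epsilon>1 \<le> (\<Sum>i\<in>T. a $ i)"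
    using uniform_slack[of "{T. card T + s = CARD('n)}" "\<lambda>_. 0" "\<lambda>T. \<Sum>i\<in>T. a $ i" 1] pos by auto
  \<comment> \<open>Taking at most half of \<open>b $ p\<close> keeps the remainder at
    \<open>p\<close> positive, as \<open>split\<close> requires.\<close>
  define \<epsilon> where "\<epsilon> = min \<epsilon>1 (b $ p / 2)"
  have \<epsilon>: "0 < \<epsilon>" "\<epsilon> < b $ p" using \<epsilon>1(1) b(1)[OF p(1)] by (auto simp: \<epsilon>_def)
  have \<epsilon>_le: "\<epsilon> \<le> (\<Sum>i\<in>T. a $ i)" if "card T + s = CARD('n)" for T
    using \<epsilon>1(2)[OF that] by (simp add: \<epsilon>_def)
  define y where "y = (\<chi> i. if i = p then b $ p - \<epsilon> else if i = e then \<epsilon> else b $ i)"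
  have ypos: "0 < y $ i" if "i \<in> insert e S" for i using that \<epsilon> b by (auto simp: y_def)
  have yzero: "y $ i = 0" if "i \<notin> insert e S" for i using that p b by (auto simp: y_def)
  have ynonneg: "0 \<le> y $ i" for i
    using ypos[of i] yzero[of i] by (cases "i \<in> insert e S") (auto intro: less_imp_le)
  have "R b < R y"
  proof -
    obtain m where m: "s = Suc m" using s by (cases s) auto
    have "card {1..m} = card (S - {p})" using S p m by simp
    then obtain h where h: "bij_betw h {1..m} (S - {p})"
      using finite_same_card_bij[of "{1..m}" "S - {p}"] by auto
    \<comment> \<open>The two pieces occupy positions \<open>s\<close> and \<open>s+1\<close>, which
      \<open>split\<close> merges.\<close>
    define h' where "h' = h(s := p, s+1 := e)"
    have "bij_betw h' {1..m} (S - {p})" using h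
      by (rule bij_betw_cong[THEN iffD1, rotated]) (simp add: h'_def m)
    then have "bij_betw h' ({1..m} \<union> {s}) ((S - {p}) \<union> {p})"
      by (rule bij_betw_combine) (auto simp: h'_def)
    moreover have "{1..m} \<union> {s} = {1..s}" "S - {p} \<union> {p} = S" using m p by auto
    ultimately have h1: "bij_betw h' {1..s} S" by simp
    then have "bij_betw h' ({1..s} \<union> {s+1}) (S \<union> {e})"
      by (rule bij_betw_combine) (use e in \<open>auto simp: h'_def\<close>)
    moreover have "{1..s} \<union> {s+1} = {1..s+1}" by auto
    ultimately have h2: "bij_betw h' {1..s+1} (insert e S)" by simp
    let ?z = "\<lambda>j. y $ h' j"
    have bz: "b $ h' j = (?z(s := ?z s + ?z (s+1))) j" if j: "j \<in> {1..s}" for j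
    proof (cases "j = s")
      case True
      then show ?thesis using e p by (auto simp: h'_def y_def)
    next
      case False
      have "h' j \<noteq> h' s" 
        using inj_on_eq_iff[OF bij_betw_imp_inj_on[OF h1], of j s] j s False by auto
      then have "h' j \<noteq> p" by (simp add: h'_def)
      moreover have "h' j \<noteq> e" using bij_betwE[OF h1] j e by auto
      ultimately show ?thesis using False by (simp add: y_def)
    qed
    have "R b = R (leading_vec idx s (\<lambda>j. b $ h' j))" using leading[OF h1, of b] b by simp
    also have "leading_vec idx s (\<lambda>j. b $ h' j) = leading_vec idx s (?z(s := ?z s + ?z (s+1)))"
      unfolding leading_vec_def by (rule sum.cong) (simp_all only: bz)
    also have "R \<dots> < R (leading_vec idx (s+1) ?z)"
      using bij_betwE[OF h2] ypos by (intro split[rule_format]) auto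
    also have "\<dots> = R y" using leading[OF h2, of y] yzero by simp
    finally show ?thesis .
  qed
  also have "R y \<le> R a"
  proof (rule supermajorization)
    fix T :: "'n set"
    have ye: "(\<Sum>i\<in>- S. y $ i) = \<epsilon>"
    proof -
      have "(\<Sum>i\<in>- S. y $ i) = (\<Sum>i\<in>- S. if i = e then \<epsilon> else 0)"
        using e p b by (intro sum.cong) (auto simp: y_def)
      then show ?thesis using e by simp
    qed
    have cS: "card (- S) + s = CARD('n)" using card_Compl_add[of S] S by simp
    consider "card T + s < CARD('n)" | "card T + s = CARD('n)" | "CARD('n) < card T + s" by linarith
    then show "\<exists>T'. card T' = card T \<and> (\<Sum>i\<in>T'. y $ i) \<le> (\<Sum>i\<in>T. a $ i)"
    proof cases
      case 1
      then obtain T' where T': "T' \<subseteq> - insert e S" "card T' = card T"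
        using obtain_subset_avoiding[OF e, of T] S by auto
      have "(\<Sum>i\<in>T'. y $ i) = 0" using T'(1) yzero by (intro sum.neutral) auto
      then show ?thesis using T'(2) a by (auto intro!: exI[of _ T'] sum_nonneg)
    next
      case 2
      then show ?thesis using ye \<epsilon>_le cS by (intro exI[of _ "- S"]) auto
    next
      case 3
      then obtain J where J: "J \<subseteq> S" "card J + CARD('n) = card T + s"
        "(\<Sum>i\<in>J. b $ i) \<le> (\<Sum>i\<in>T. a $ i)" using le[of T] by auto
      \<comment> \<open>Trading a member of \<open>J\<close> for \<open>p\<close> cannot raise the
        sum, since \<open>b\<close> is minimal on \<open>S\<close> at \<open>p\<close>. With
        \<open>p\<close> in \<open>K\<close> the loss there cancels the gain at
        \<open>e\<close>.\<close>
      obtain K where K: "K \<subseteq> S" "card K = card J" "p \<in> K" "(\<Sum>i\<in>K. b $ i) \<le> (\<Sum>i\<in>J. b $ i)"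
      proof (cases "p \<in> J")
        case False
        have "J \<noteq> {}" using J(2) 3 by auto
        then obtain q where q: "q \<in> J" by auto
        have "card (insert p (J - {q})) = card J" using False q
          by (simp add: card_gt_0_iff card_Diff_singleton) (metis Suc_pred card_gt_0_iff empty_iff finite)
        moreover have "(\<Sum>i\<in>insert p (J - {q}). b $ i) \<le> (\<Sum>i\<in>J. b $ i)"
          using False q pmin[of q] J(1) by (auto simp: sum_diff1)
        ultimately show thesis using J(1) p by (intro that[of "insert p (J - {q})"]) auto
      qed (use J that in blast)
      have disj: "K \<inter> - S = {}" using K by auto
      have "card (K \<union> - S) = card T" using card_Un_disjoint[of K "- S"] disj J(2) K(2) cS by simp
      moreover have "(\<Sum>i\<in>K \<union> - S. y $ i) = (\<Sum>i\<in>K. y $ i) + \<epsilon>"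
        using disj ye by (subst sum.union_disjoint) auto
      moreover have "(\<Sum>i\<in>K. y $ i) = (\<Sum>i\<in>K. b $ i - (if i = p then \<epsilon> else 0))"
        using K(1) e by (intro sum.cong) (auto simp: y_def)
      then have "(\<Sum>i\<in>K. y $ i) = (\<Sum>i\<in>K. b $ i) - \<epsilon>" using K(3) by (simp add: sum_subtractf)
      ultimately show ?thesis using J(3) K(4) by (intro exI[of _ "K \<union> - S"]) auto
    qed
  qed (rule ynonneg)
  finally show ?thesis .
qed

text \<open>Enlarging entry \<open>s\<close> by \<open>z (s+1)\<close> does not decrease
  \<open>R\<close>. This makes raising coordinates available under the splitting hypothesis too, for
  supports smaller than \<open>s\<close>.\<close>

lemma increasing_of_split:
  assumes split: "\<forall>z. (\<forall>j\<in>{1..s+1}. z j > 0) \<longrightarrow>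
      R (leading_vec idx s (z(s := z s + z (s+1)))) < R (leading_vec idx (s+1) z)"
  shows "\<forall>z. (\<forall>j\<in>{1..s+1}. z j > 0) \<longrightarrow>
      R (leading_vec idx s z) < R (leading_vec idx (s+1) z)"
proof (intro allI impI)
  fix z :: "nat \<Rightarrow> real" assume z: "\<forall>j\<in>{1..s+1}. z j > 0"
  then have "0 \<le> z j" if "j \<in> {1..s+1}" for j using that by (auto intro: less_imp_le)
  then have "R (leading_vec idx s z) \<le> R (leading_vec idx s (z(s := z s + z (s+1))))"
    by (intro mono) (auto simp: leading_vec_nth intro!: sum_nonneg sum_mono)
  also have "\<dots> < R (leading_vec idx (s+1) z)" using split z by blast
  finally show "R (leading_vec idx s z) < R (leading_vec idx (s+1) z)" .
qed

end

section \<open>Equality in the null space inequalities\<close>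

text \<open>Off the \<open>s\<close>-set \<open>U\<close> the vector \<open>v\<close> cancels
  \<open>x\<close>, which forces both \<open>S\<close> and \<open>U\<close> to carry exactly half
  the mass of \<open>v\<close>. Exchanging single coordinates then shows that \<open>v\<close> has
  constant magnitude on \<open>S\<close>, where it equals \<open>- x\<close>.\<close>

lemma equal_height_of_vanishing_shift:
  fixes x v :: "real ^ 'n"
  assumes nsp: "\<And>S'. card S' = s \<Longrightarrow> 2 * (\<Sum>i\<in>S'. \<bar>v $ i\<bar>) \<le> (\<Sum>i\<in>UNIV. \<bar>v $ i\<bar>)"
    and v: "v \<noteq> 0" and s: "1 \<le> s" and S: "card {i. x $ i \<noteq> 0} = s"
    and T: "card T + s = CARD('n)" "\<And>i. i \<in> T \<Longrightarrow> x $ i + v $ i = 0"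
  shows "equal_height x"
proof -
  define S where "S = {i. x $ i \<noteq> 0}"
  define U where "U = - T"
  define w where "w i = \<bar>v $ i\<bar>" for i
  have cS: "card S = s" using S by (simp add: S_def)
  have cU: "card U = s" using T(1) card_Compl_add[of T] by (simp add: U_def)
  have nspw: "2 * sum w S' \<le> sum w UNIV" if "card S' = s" for S' using nsp[OF that] by (simp add: w_def)
  have wn: "0 \<le> w i" for i by (simp add: w_def)
  have "x $ i = 0" if "i \<in> T - S" for i using that by (simp add: S_def)
  then have wTS: "w i = 0" if "i \<in> T - S" for i using T(2)[of i] that by (simp add: w_def)
  have "sum w {} + sum w (S - T) + 0 \<le> sum w (T - S)"
    by (rule nsp_exchange[of s]) (use nspw cS T in auto)
  then have "sum w (S - T) \<le> 0" using wTS by simp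
  then have "sum w (S - T) = 0" using wn by (simp add: sum_nonneg order_antisym)
  then have wSU: "w i = 0" if "i \<in> S \<inter> U" for i
    using that sum_nonneg_eq_0_iff[of "S - T" w] wn by (auto simp: U_def)
  have "sum w UNIV = sum w (S \<union> U)"
    using wTS by (intro sum.mono_neutral_right) (auto simp: U_def)
  moreover have "sum w (S \<union> U) + sum w (S \<inter> U) = sum w S + sum w U" by (rule sum.union_inter) auto
  moreover have "sum w (S \<inter> U) = 0" using wSU by (intro sum.neutral) auto
  ultimately have half: "2 * sum w S = sum w UNIV" "2 * sum w U = sum w UNIV"
    using nspw[OF cS] nspw[OF cU] by linarith+
  \<comment> \<open>Replacing \<open>p\<close> by \<open>q\<close> keeps the size, and a set already
    carrying half the mass may not gain any.\<close>
  have swap: "w q \<le> w p" if "card V = s" "2 * sum w V = sum w UNIV" "p \<in> V" "q \<notin> V" for V p q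
  proof -
    have "card (insert q (V - {p})) = s" using that s by (simp add: card_Diff_singleton)
    from nspw[OF this] have "2 * (w q + (sum w V - w p)) \<le> sum w UNIV"
      using that by (simp add: sum_diff1)
    then show ?thesis using that(2) by simp
  qed
  have "sum w UNIV \<noteq> 0" using v by (auto simp: w_def sum_nonneg_eq_0_iff vec_eq_iff)
  \<comment> \<open>A common point carries no mass, so by \<open>swap\<close> nothing outside
    \<open>S\<close> does; then \<open>U\<close> has mass 0 and \<open>v\<close> vanishes.\<close>
  have disj: "S \<inter> U = {}"
  proof (rule ccontr)
    assume "S \<inter> U \<noteq> {}"
    then obtain c where c: "c \<in> S \<inter> U" by auto
    have "w q = 0" if "q \<in> U" for q
    proof (cases "q \<in> S")
      case False
      then show ?thesis using swap[OF cS half(1), of c q] c wSU[OF c] wn[of q] by simp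
    qed (use wSU that in auto)
    then have "sum w U = 0" by (intro sum.neutral) auto
    then show False using half \<open>sum w UNIV \<noteq> 0\<close> by simp
  qed
  have "U \<noteq> {}" using cU s by auto
  then obtain q where q: "q \<in> U" by auto
  have "\<bar>x $ i\<bar> = w q" if "i \<in> S" for i
  proof -
    have i: "i \<notin> U" "q \<notin> S" using disj q that by auto
    then have "x $ i + v $ i = 0" using T(2) by (simp add: U_def)
    then have "\<bar>x $ i\<bar> = w i" by (simp add: w_def abs_if)
    moreover have "w i = w q" 
      using swap[OF cS half(1) that i(2)] swap[OF cU half(2) q i(1)] by simp
    ultimately show ?thesis by simp
  qed
  then show ?thesis by (auto simp: equal_height_def S_def)
qed

section \<open>Uniqueness of sparse minimizers\<close>

lemma l1_norm_restrict_vec: "l1_norm (restrict_vec v S) = (\<Sum>i\<in>S. \<bar>v $ i\<bar>)"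
  unfolding l1_norm_def restrict_vec_def
  by (simp add: if_distrib[of abs] sum.If_cases)

lemma l1_norm_restrict_vec_Compl:
  "l1_norm (restrict_vec v (- S)) = (\<Sum>i\<in>UNIV. \<bar>v $ i\<bar>) - (\<Sum>i\<in>S. \<bar>v $ i\<bar>)"
  unfolding l1_norm_restrict_vec by (simp add: Compl_eq_Diff_UNIV sum_diff)

lemma (in concave_penalty) unique_solution_strict_nsp:
  fixes A :: "real ^ 'n ^ 'm"
  assumes incr: "\<forall>z. (\<forall>j\<in>{1..s+1}. z j > 0) \<longrightarrow>
      R (leading_vec idx s z) < R (leading_vec idx (s+1) z)"
    and nsp: "\<And>v S. v \<in> mat_ker A - {0} \<Longrightarrow> card S \<le> s \<Longrightarrow>
      2 * (\<Sum>i\<in>S. \<bar>v $ i\<bar>) < (\<Sum>i\<in>UNIV. \<bar>v $ i\<bar>)"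
    and x: "sparse_vec s x"
  shows "unique_solution R A x"
  unfolding unique_solution_def
proof (intro allI impI)
  fix z assume z: "z \<noteq> x \<and> A *v z = A *v x"
  define v where "v = z - x"
  have zv: "x $ i + v $ i = z $ i" for i by (simp add: v_def)
  have v: "v \<in> mat_ker A - {0}" using z by (simp add: v_def mat_ker_def matrix_vector_mult_diff_distrib)
  \<comment> \<open>There are finitely many \<open>s\<close>-sets, so one gap serves all of them and
    makes every subset sum comparison below strict.\<close>
  obtain \<delta> where \<delta>: "\<delta> > 0"
    "\<And>S. card S = s \<Longrightarrow> 2 * (\<Sum>i\<in>S. \<bar>v $ i\<bar>) + \<delta> \<le> (\<Sum>i\<in>UNIV. \<bar>v $ i\<bar>)"
    using uniform_slack[of "{S. card S = s}" "\<lambda>S. 2 * (\<Sum>i\<in>S. \<bar>v $ i\<bar>)" "\<lambda>_. \<Sum>i\<in>UNIV. \<bar>v $ i\<bar>" 1]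
      nsp[OF v] by auto
  obtain S where S: "{i. x $ i \<noteq> 0} \<subseteq> S" "card S = s"
    using exists_subset_between[of "{i. x $ i \<noteq> 0}" s UNIV] x s by (auto simp: sparse_vec_def)
  have "R (\<chi> i. \<bar>x $ i\<bar>) < R (\<chi> i. \<bar>z $ i\<bar>)"
  proof (rule less_of_strict_subset_sums[OF incr S(2)])
    fix T :: "'n set" assume T: "CARD('n) \<le> card T + s"
    obtain J where J: "J \<subseteq> S \<inter> T" "card J + CARD('n) = card T + s"
      by (rule obtain_inter_subset[OF S(2) T])
    have "(\<Sum>i\<in>J. \<bar>x $ i\<bar>) + (\<Sum>i\<in>S - T. \<bar>v $ i\<bar>) + \<delta> \<le> (\<Sum>i\<in>T. \<bar>x $ i + v $ i\<bar>)"
      by (rule subset_sum_shift_ge[OF \<delta>(2) S(2) _ J]) (use S(1) in auto)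
    moreover have "0 \<le> (\<Sum>i\<in>S - T. \<bar>v $ i\<bar>)" by (simp add: sum_nonneg)
    ultimately have "(\<Sum>i\<in>J. \<bar>x $ i\<bar>) < (\<Sum>i\<in>T. \<bar>x $ i + v $ i\<bar>)" using \<delta>(1) by linarith
      then show "\<exists>J\<subseteq>S. card J + CARD('n) = card T + s \<and>
        (\<Sum>i\<in>J. (\<chi> i. \<bar>x $ i\<bar>) $ i) < (\<Sum>i\<in>T. (\<chi> i. \<bar>z $ i\<bar>) $ i)"
      using J by (intro exI[of _ J]) (simp add: zv)
  qed (use S(1) in auto)
  then show "R x < R z" using abs_eq[of x] abs_eq[of z] by simp
qed

text \<open>With exactly \<open>s\<close> nonzero entries the smallest is split, and failure of
  positivity would make \<open>x\<close> equal-height. With fewer, a coordinate \<open>k\<close>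
  outside the support with \<open>v $ k\<close> nonzero supplies the strictness that the weak
  inequalities lack.\<close>

lemma (in concave_penalty) unique_solution_weak_nsp:
  fixes A :: "real ^ 'n ^ 'm"
  assumes split: "\<forall>z. (\<forall>j\<in>{1..s+1}. z j > 0) \<longrightarrow>
      R (leading_vec idx s (z(s := z s + z (s+1)))) < R (leading_vec idx (s+1) z)"
    and nsp: "\<And>v S. v \<in> mat_ker A - {0} \<Longrightarrow> card S \<le> s \<Longrightarrow>
      2 * (\<Sum>i\<in>S. \<bar>v $ i\<bar>) \<le> (\<Sum>i\<in>UNIV. \<bar>v $ i\<bar>)"
    and x: "sparse_vec s x" "\<not> equal_height x"
  shows "unique_solution R A x"
  unfolding unique_solution_def
proof (intro allI impI)
  fix z assume z: "z \<noteq> x \<and> A *v z = A *v x"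
  define v where "v = z - x"
  have zv: "x $ i + v $ i = z $ i" for i by (simp add: v_def)
  have v: "v \<in> mat_ker A - {0}" using z by (simp add: v_def mat_ker_def matrix_vector_mult_diff_distrib)
  have nsp0: "2 * (\<Sum>i\<in>S. \<bar>v $ i\<bar>) + 0 \<le> (\<Sum>i\<in>UNIV. \<bar>v $ i\<bar>)" if "card S = s" for S
    using nsp[OF v, of S] that by simp
  define X where "X = {i. x $ i \<noteq> 0}"
  have X: "card X \<le> s" "\<And>i. i \<notin> X \<Longrightarrow> x $ i = 0" using x(1) by (simp_all add: X_def sparse_vec_def)
  have "R (\<chi> i. \<bar>x $ i\<bar>) < R (\<chi> i. \<bar>z $ i\<bar>)"
  proof (cases "card X = s")
    case True
    show ?thesis
    proof (rule less_of_split[OF split True])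
      fix T :: "'n set" assume T: "CARD('n) \<le> card T + s"
      obtain J where J: "J \<subseteq> X \<inter> T" "card J + CARD('n) = card T + s"
        by (rule obtain_inter_subset[OF True T])
      have "(\<Sum>i\<in>J. \<bar>x $ i\<bar>) + (\<Sum>i\<in>X - T. \<bar>v $ i\<bar>) + 0 \<le> (\<Sum>i\<in>T. \<bar>x $ i + v $ i\<bar>)"
        by (rule subset_sum_shift_ge[OF nsp0 True X(2) J])
      moreover have "0 \<le> (\<Sum>i\<in>X - T. \<bar>v $ i\<bar>)" by (simp add: sum_nonneg)
      ultimately have "(\<Sum>i\<in>J. \<bar>x $ i\<bar>) \<le> (\<Sum>i\<in>T. \<bar>x $ i + v $ i\<bar>)" by linarith
      then show "\<exists>J\<subseteq>X. card J + CARD('n) = card T + s \<and>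
          (\<Sum>i\<in>J. (\<chi> i. \<bar>x $ i\<bar>) $ i) \<le> (\<Sum>i\<in>T. (\<chi> i. \<bar>z $ i\<bar>) $ i)"
        using J by (intro exI[of _ J]) (simp add: zv)
    next
      fix T :: "'n set" assume T: "card T + s = CARD('n)"
      show "0 < (\<Sum>i\<in>T. (\<chi> i. \<bar>z $ i\<bar>) $ i)"
      proof (rule ccontr)
        assume "\<not> ?thesis"
        then have "(\<Sum>i\<in>T. \<bar>z $ i\<bar>) = 0" by (simp add: not_less order_antisym sum_nonneg)
        then have "x $ i + v $ i = 0" if "i \<in> T" for i
          using that by (simp add: sum_nonneg_eq_0_iff v_def)
        then have "equal_height x"
          using equal_height_of_vanishing_shift[of s v x T] nsp[OF v] v s T True by (auto simp: X_def)
        then show False using x(2) by simp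
      qed
    qed (auto simp: X_def)
  next
    case False
    then have less: "card X < s" using X(1) by simp
    \<comment> \<open>If \<open>v\<close> lived on \<open>X\<close>, the inequality for
      \<open>X\<close> would bound its whole mass by half of itself.\<close>
    have "\<exists>i. i \<notin> X \<and> v $ i \<noteq> 0"
    proof (rule ccontr)
      assume "\<not> ?thesis"
      then have off: "v $ i = 0" if "i \<notin> X" for i using that by blast
      have "(\<Sum>i\<in>UNIV. \<bar>v $ i\<bar>) = (\<Sum>i\<in>X. \<bar>v $ i\<bar>)"
        using off by (intro sum.mono_neutral_right) auto
      then have "(\<Sum>i\<in>UNIV. \<bar>v $ i\<bar>) \<le> 0" using nsp[OF v X(1)] by simp
      then have "(\<Sum>i\<in>UNIV. \<bar>v $ i\<bar>) = 0" by (simp add: order_antisym sum_nonneg)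
      then show False using v by (auto simp: sum_nonneg_eq_0_iff vec_eq_iff)
    qed
    then obtain k where k: "k \<notin> X" "v $ k \<noteq> 0" by blast
    then have "card (insert k X) \<le> s" using less by simp
    \<comment> \<open>With \<open>k\<close> in \<open>S\<close> it always contributes: as a point of
      \<open>S - T\<close>, as a point of \<open>T\<close> when \<open>J\<close> is empty, or as a
      member of \<open>J\<close>.\<close>
    then obtain S where S: "insert k X \<subseteq> S" "card S = s"
      using exists_subset_between[of "insert k X" s UNIV] s by auto
    have Sx: "x $ i = 0" if "i \<notin> S" for i using that S(1) X(2) by auto
    show ?thesis
    proof (rule less_of_strict_subset_sums[OF increasing_of_split[OF split] S(2)])
      fix T :: "'n set" assume T: "CARD('n) \<le> card T + s"
      obtain J where J: "J \<subseteq> S \<inter> T" "card J + CARD('n) = card T + s"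
        and kJ: "k \<in> S \<inter> T \<Longrightarrow> CARD('n) < card T + s \<Longrightarrow> k \<in> J"
        using obtain_inter_subset[OF S(2) T, where i = k] by blast
      have "(\<Sum>i\<in>J. \<bar>x $ i\<bar>) < (\<Sum>i\<in>T. \<bar>x $ i + v $ i\<bar>)"
      proof (cases "k \<in> T")
        case False
        then have "\<bar>v $ k\<bar> \<le> (\<Sum>i\<in>S - T. \<bar>v $ i\<bar>)" using S(1) by (intro member_le_sum) auto
        moreover have "(\<Sum>i\<in>J. \<bar>x $ i\<bar>) + (\<Sum>i\<in>S - T. \<bar>v $ i\<bar>) + 0 \<le> (\<Sum>i\<in>T. \<bar>x $ i + v $ i\<bar>)"
          by (rule subset_sum_shift_ge[OF nsp0 S(2) Sx J])
        ultimately show ?thesis using k(2) by simp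
      next
        case kT: True
        show ?thesis
        proof (cases "CARD('n) = card T + s")
          case True
          then have "J = {}" using J(2) by simp
          moreover have "\<bar>x $ k + v $ k\<bar> \<le> (\<Sum>i\<in>T. \<bar>x $ i + v $ i\<bar>)"
            using kT by (intro member_le_sum) auto
          ultimately show ?thesis using k X(2) by simp
        next
          case False
          then have "k \<in> J" using kJ kT S(1) T by auto
          \<comment> \<open>The triangle inequality is strict at \<open>k\<close>, where
            \<open>x\<close> vanishes and \<open>v\<close> does not.\<close>
          have "(\<Sum>i\<in>J. \<bar>x $ i\<bar>) < (\<Sum>i\<in>J. \<bar>x $ i + v $ i\<bar> + \<bar>v $ i\<bar>)"
            by (rule sum_strict_mono_ex1) (use \<open>k \<in> J\<close> k X(2) in \<open>auto intro!: bexI[of _ k]\<close>)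
          moreover have "(\<Sum>i\<in>J. \<bar>v $ i\<bar>) + (\<Sum>i\<in>S - T. \<bar>v $ i\<bar>) + 0 \<le> (\<Sum>i\<in>T - S. \<bar>v $ i\<bar>)"
            by (rule nsp_exchange[OF nsp0 S(2) J])
          moreover have "0 \<le> (\<Sum>i\<in>S - T. \<bar>v $ i\<bar>)" by (simp add: sum_nonneg)
          ultimately show ?thesis using sum_abs_shift_ge[OF Sx J(1), of v]
            unfolding sum.distrib by linarith
        qed
      qed
      then show "\<exists>J\<subseteq>S. card J + CARD('n) = card T + s \<and>
          (\<Sum>i\<in>J. (\<chi> i. \<bar>x $ i\<bar>) $ i) < (\<Sum>i\<in>T. (\<chi> i. \<bar>z $ i\<bar>) $ i)"
        using J by (intro exI[of _ J]) (simp add: zv)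
    qed (use Sx in auto)
  qed
  then show "R x < R z" using abs_eq[of x] abs_eq[of z] by simp
qed

theorem theorem3p1:
  fixes A :: "real ^ 'n ^ 'm"
    and R :: "real ^ 'n \<Rightarrow> real"
    and s :: nat
    and idx :: "nat \<Rightarrow> 'n"
  assumes "CARD('n) > 1"
    and "1 \<le> s" and "real s < real CARD('n) / 2"
    and "bij_betw idx {1..CARD('n)} UNIV"
    and "\<And>z. 0 \<le> R z"
    and "\<And>z. R z = R (\<chi> i. \<bar>z $ i\<bar>)"
    and "symmetric_fun R"
    and "concave_on nonneg_orthant R"
  shows
    "((\<forall>z. (\<forall>j\<in>{1..s+1}. z j > 0) \<longrightarrow>
          R (leading_vec idx (s+1) z) > R (leading_vec idx s z)) \<longrightarrow>
      mat_ker A - {0} \<subseteq>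
        {v. \<forall>S. card S \<le> s \<longrightarrow>
              l1_norm (restrict_vec v S) < l1_norm (restrict_vec v (- S))} \<longrightarrow>
      (\<forall>x. sparse_vec s x \<longrightarrow> unique_solution R A x))
     \<and>
     ((\<forall>z. (\<forall>j\<in>{1..s+1}. z j > 0) \<longrightarrow>
          R (leading_vec idx (s+1) z) > R (leading_vec idx s (z(s := z s + z (s+1))))) \<longrightarrow>
      mat_ker A - {0} \<subseteq>
        {v. \<forall>S. card S \<le> s \<longrightarrow>
              l1_norm (restrict_vec v S) \<le> l1_norm (restrict_vec v (- S))} \<longrightarrow>
      (\<forall>x. sparse_vec s x \<and> \<not> equal_height x \<longrightarrow> unique_solution R A x))"
proof (intro conjI impI allI)
  interpret concave_penalty R idx s
    by unfold_locales (use assms in auto)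
  fix x :: "real ^ 'n"
  assume incr: "\<forall>z. (\<forall>j\<in>{1..s+1}. z j > 0) \<longrightarrow> R (leading_vec idx (s+1) z) > R (leading_vec idx s z)"
    and nsp: "mat_ker A - {0} \<subseteq>
        {v. \<forall>S. card S \<le> s \<longrightarrow> l1_norm (restrict_vec v S) < l1_norm (restrict_vec v (- S))}"
    and x: "sparse_vec s x"
  show "unique_solution R A x"
  proof (rule unique_solution_strict_nsp[OF incr _ x])
    fix v and S :: "'n set" assume "v \<in> mat_ker A - {0}" "card S \<le> s"
    then have "l1_norm (restrict_vec v S) < l1_norm (restrict_vec v (- S))" using nsp by blast
    then show "2 * (\<Sum>i\<in>S. \<bar>v $ i\<bar>) < (\<Sum>i\<in>UNIV. \<bar>v $ i\<bar>)"
      unfolding l1_norm_restrict_vec_Compl by (simp add: l1_norm_restrict_vec)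
  qed
next
  interpret concave_penalty R idx s
    by unfold_locales (use assms in auto)
  fix x :: "real ^ 'n"
  assume split: "\<forall>z. (\<forall>j\<in>{1..s+1}. z j > 0) \<longrightarrow>
      R (leading_vec idx (s+1) z) > R (leading_vec idx s (z(s := z s + z (s+1))))"
    and nsp: "mat_ker A - {0} \<subseteq>
        {v. \<forall>S. card S \<le> s \<longrightarrow> l1_norm (restrict_vec v S) \<le> l1_norm (restrict_vec v (- S))}"
    and x: "sparse_vec s x \<and> \<not> equal_height x"
  show "unique_solution R A x"
  proof (rule unique_solution_weak_nsp[OF split])
    fix v and S :: "'n set" assume "v \<in> mat_ker A - {0}" "card S \<le> s"
    then have "l1_norm (restrict_vec v S) \<le> l1_norm (restrict_vec v (- S))" using nsp by blast
    then show "2 * (\<Sum>i\<in>S. \<bar>v $ i\<bar>) \<le> (\<Sum>i\<in>UNIV. \<bar>v $ i\<bar>)"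
      unfolding l1_norm_restrict_vec_Compl by (simp add: l1_norm_restrict_vec)
  qed (use x in blast)+
qed

end
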